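(* Let $\mathcal{A}$ be a (randomized) algorithm that solves the wake-up problem with high probability in $f(n,\mathcal{C})$ rounds in the radio network model with $\mathcal{C}$ channels and collision detection (that is, for every network size $n$, every number of channels $\mathcal{C}$ and every non-empty set of activated nodes, the problem is solved within $f(n,\mathcal{C})$ rounds with probability at least $1-\frac1n$). Then for every $\mathcal{C}\ge 2$, $f(n,\mathcal{C})\in\Omega\!\left(\frac{\log n}{\log\mathcal{C}}+\log\log n\right)$.
   Context: Multichannel radio network model (single hop, with collision detection): there are $n$ nodes with unique ids from $[n]=\{1,\dots,n\}$, every two of which are neighbors, and $\mathcal{C}\ge1$ orthogonal channels. Executions proceed in synchronous rounds. In each round each node chooses a single channel and either transmits a message or receives on it. A node $u$ receives a message from $v$ on channel $c$ in a round if and only if $u$ receives on $c$, $v$ transmits on $c$, and no other neighbor of $u$ transmits on $c$ in that round. Collision detection (applied separately on each channel): a node receiving on a channel can distinguish between silence (no neighbor transmits on it) and collision (two or more neighbors transmit on it); moreover a node transmitting on a channel can distinguish between transmitting alone on it and transmitting simultaneously with one or more other nodes on it. Wake-up problem: all nodes are initially inactive; at the beginning of the execution an adversary activates an arbitrary non-empty subset of the nodes. Inactive nodes can only listen, all on the same known default channel (channel $1$), and detecting a collision does not wake them up; active nodes execute an arbitrary randomized algorithm and have no advance knowledge of the identities of the other active nodes. The problem is solved in the first round in which exactly one active node transmits on channel $1$. Asymptotics are in $n\to\infty$, with $\mathcal{C}$ quantified first as in the claim. *)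

theory Defs
  imports "HOL-Probability.Probability" "HOL-Library.Landau_Symbols"
begin

text \<open>
  Single-hop radio network with collision detection. The nodes are \<open>{1..n}\<close>, any two of them are
  neighbors, and the channels are \<open>{1..C}\<close>, channel 1 being the default one. The type \<open>'m\<close> of messages
  is arbitrary.
\<close>

datatype 'm action = Transmit (channel: nat) (message: 'm) | Receive (channel: nat)

text \<open>
  The first three values are what a receiving node perceives, the last two what a transmitting
  node perceives.
\<close>

datatype 'm feedback = Silence | Received 'm | Collision | Sent_Alone | Sent_Jammed

text \<open>The actions of all nodes in one round.\<close>

type_synonym 'm profile = "nat \<Rightarrow> 'm action"

definition transmitters :: "nat \<Rightarrow> 'm profile \<Rightarrow> nat \<Rightarrow> nat set" where
  "transmitters n a c = {v \<in> {1..n}. \<exists>m. a v = Transmit c m}"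

definition feedback :: "nat \<Rightarrow> 'm profile \<Rightarrow> nat \<Rightarrow> 'm feedback" where
  "feedback n a u =
     (case a u of
        Transmit c m \<Rightarrow> if transmitters n a c = {u} then Sent_Alone else Sent_Jammed
      | Receive c \<Rightarrow>
          if transmitters n a c = {} then Silence
          else if card (transmitters n a c) = 1
            then Received (message (a (the_elem (transmitters n a c))))
          else Collision)"

text \<open>A transcript lists the rounds played so far in chronological order; the view of a node is the
  part of it that the node observes: its own actions and the feedback it got.\<close>

type_synonym 'm transcript = "'m profile list"

type_synonym 'm view = "('m action \<times> 'm feedback) list"

definition view :: "nat \<Rightarrow> 'm transcript \<Rightarrow> nat \<Rightarrow> 'm view" where
  "view n tr u = map (\<lambda>a. (a u, feedback n a u)) tr"

text \<open>
  A randomized algorithm: given \<open>n\<close>, \<open>C\<close>, the id of an active node and its view, the distribution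
  of the node's next action. Since a node recalls its whole view, in particular its own past
  actions, private random bits kept between rounds would allow no further behaviour (for countable \<open>'m\<close>).
\<close>

type_synonym 'm algorithm = "nat \<Rightarrow> nat \<Rightarrow> nat \<Rightarrow> 'm view \<Rightarrow> 'm action pmf"

definition respects_channels :: "'m algorithm \<Rightarrow> bool" where
  "respects_channels A \<longleftrightarrow>
     (\<forall>n \<ge> 1. \<forall>C \<ge> 1. \<forall>u \<in> {1..n}. \<forall>h. \<forall>x \<in> set_pmf (A n C u h). channel x \<in> {1..C})"

text \<open>\<open>S\<close> is the set of nodes activated by the adversary. Any other node wakes up once it receives a
  message (but not when it detects a collision);
  the first such message is only delivered in a round in which the problem is solved.\<close>

definition active :: "nat \<Rightarrow> nat set \<Rightarrow> 'm transcript \<Rightarrow> nat \<Rightarrow> bool" where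
  "active n S tr u \<longleftrightarrow> u \<in> S \<or> (\<exists>a \<in> set tr. \<exists>m. feedback n a u = Received m)"

definition next_action ::
    "'m algorithm \<Rightarrow> nat \<Rightarrow> nat \<Rightarrow> nat set \<Rightarrow> 'm transcript \<Rightarrow> nat \<Rightarrow> 'm action pmf" where
  "next_action A n C S tr u =
     (if active n S tr u then A n C u (view n tr u) else return_pmf (Receive 1))"

text \<open>Distribution of the transcript of the first rounds. In each round the nodes randomize
  independently of each other; the value \<open>Receive 1\<close> outside \<open>{1..n}\<close> is a dummy.\<close>

primrec execution :: "'m algorithm \<Rightarrow> nat \<Rightarrow> nat \<Rightarrow> nat set \<Rightarrow> nat \<Rightarrow> 'm transcript pmf" where
  "execution A n C S 0 = return_pmf []"
| "execution A n C S (Suc t) =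
     bind_pmf (execution A n C S t)
       (\<lambda>tr. map_pmf (\<lambda>a. tr @ [a])
               (Pi_pmf {1..n} (Receive 1) (next_action A n C S tr)))"

text \<open>Inactive nodes never transmit in an execution, so the transmitters are all active.\<close>

definition solved :: "nat \<Rightarrow> 'm transcript \<Rightarrow> bool" where
  "solved n tr \<longleftrightarrow> (\<exists>a \<in> set tr. card (transmitters n a 1) = 1)"

definition solves_wakeup_whp :: "'m algorithm \<Rightarrow> (nat \<Rightarrow> nat \<Rightarrow> nat) \<Rightarrow> bool" where
  "solves_wakeup_whp A f \<longleftrightarrow>
     (\<forall>n \<ge> 1. \<forall>C \<ge> 1. \<forall>S. S \<noteq> {} \<and> S \<subseteq> {1..n} \<longrightarrow>
        measure_pmf.prob (execution A n C S (f n C)) {tr. solved n tr} \<ge> 1 - 1 / real n)"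

end

theory Submission
  imports Defs "HOL-Real_Asymp.Real_Asymp"
begin

text \<open>
  Activate only two nodes. As long as both choose the same channel and the same kind of action
  (transmit or receive), the problem is not solved, and each of them only learns that its
  transmission was jammed or that its channel was silent. So let every node run in isolation with
  exactly this feedback, and let \<open>p u\<close> be the distribution of the sequence of kinds and channels
  chosen by node \<open>u\<close> in \<open>T\<close> rounds. The failure probability on \<open>{u, v}\<close> is at least the collision
  probability of \<open>p u\<close> and \<open>p v\<close>, which is therefore at most \<open>1 / n\<close> for \<open>u \<noteq> v\<close>. Summing over all
  pairs of nodes and applying Cauchy--Schwarz over the \<open>(2 C) ^ T\<close> sequences
  gives \<open>n\<^sup>2 \<le> (2 C) ^ T * (2 n)\<close>. For fixed \<open>C\<close> the term \<open>ln (ln n)\<close> is dominated by \<open>ln n\<close>.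
\<close>

section \<open>Isolated runs under the feedback of a twin\<close>

definition kind :: "'m action \<Rightarrow> bool \<times> nat" where
  "kind a = (case a of Transmit c m \<Rightarrow> (True, c) | Receive c \<Rightarrow> (False, c))"

definition twin_feedback :: "'m action \<Rightarrow> 'm feedback" where
  "twin_feedback a = (case a of Transmit c m \<Rightarrow> Sent_Jammed | Receive c \<Rightarrow> Silence)"

definition twin_view :: "'m action list \<Rightarrow> 'm view" where
  "twin_view as = map (\<lambda>a. (a, twin_feedback a)) as"

text \<open>No partner is mentioned, so one and the same distribution for \<open>u\<close> serves
  every pair that contains \<open>u\<close>; the summation over all pairs relies on this.\<close>

primrec twin_run :: "'m algorithm \<Rightarrow> nat \<Rightarrow> nat \<Rightarrow> nat \<Rightarrow> nat \<Rightarrow> 'm action list pmf" where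
  "twin_run A n C u 0 = return_pmf []"
| "twin_run A n C u (Suc t) =
     bind_pmf (twin_run A n C u t)
       (\<lambda>as. map_pmf (\<lambda>a. as @ [a]) (A n C u (twin_view as)))"

definition pair_profile :: "nat \<Rightarrow> nat \<Rightarrow> 'm action \<Rightarrow> 'm action \<Rightarrow> 'm profile" where
  "pair_profile u v a b = (\<lambda>w. if w = u then a else if w = v then b else Receive 1)"

definition pair_transcript ::
    "nat \<Rightarrow> nat \<Rightarrow> 'm action list \<times> 'm action list \<Rightarrow> 'm transcript" where
  "pair_transcript u v = (\<lambda>(as, bs). map2 (pair_profile u v) as bs)"

text \<open>A nonempty list determines its prefix and its last entry, so only \<open>xs = ys\<close>
  contributes to the mass.\<close>

lemma pmf_bind_snoc:
  "pmf (bind_pmf p (\<lambda>xs. map_pmf (\<lambda>x. xs @ [x]) (q xs))) (ys @ [y]) = pmf p ys * pmf (q ys) y"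
proof -
  have *: "pmf (map_pmf (\<lambda>x. xs @ [x]) (q xs)) (ys @ [y]) = indicator {ys} xs * pmf (q ys) y" for xs
  proof (cases "xs = ys")
    case True
    have "inj (\<lambda>x. ys @ [x])" by (auto intro: injI)
    from pmf_map_inj'[OF this, of "q ys" y] True show ?thesis by simp
  next
    case False
    then show ?thesis by (auto intro!: pmf_map_outside simp: indicator_def)
  qed
  show ?thesis
    by (simp add: pmf_bind * measure_pmf_single)
qed

lemma length_twin_run: "as \<in> set_pmf (twin_run A n C u t) \<Longrightarrow> length as = t"
  by (induction t arbitrary: as) auto

section \<open>Rounds in which the two active nodes act alike\<close>

lemma transmitters_pair_profile:
  assumes "u \<in> {1..n}" "v \<in> {1..n}" "u \<noteq> v" "kind a = kind b"
  shows "transmitters n (pair_profile u v a b) c = (if kind a = (True, c) then {u, v} else {})"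
  using assms
  by (auto simp: transmitters_def pair_profile_def kind_def split: action.splits if_splits)

lemma feedback_pair_profile:
  assumes "u \<in> {1..n}" "v \<in> {1..n}" "u \<noteq> v" "kind a = kind b"
  shows "feedback n (pair_profile u v a b) u = twin_feedback a"
    and "feedback n (pair_profile u v a b) v = twin_feedback b"
    and "w \<notin> {u, v} \<Longrightarrow> feedback n (pair_profile u v a b) w \<noteq> Received m"
proof -
  have "{u, v} \<noteq> {u}" "{u, v} \<noteq> {v}" "card {u, v} \<noteq> 1"
    "pair_profile u v a b u = a" "pair_profile u v a b v = b"
    using assms(3) by (auto simp: pair_profile_def)
  note * = this transmitters_pair_profile[OF assms]
  show "feedback n (pair_profile u v a b) u = twin_feedback a"
    using * by (cases a) (simp_all add: feedback_def twin_feedback_def kind_def)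
  show "feedback n (pair_profile u v a b) v = twin_feedback b"
    using * assms(4) by (cases b) (simp_all add: feedback_def twin_feedback_def kind_def)
  \<comment> \<open>A third node listens on channel 1, where zero or two nodes transmit: it
    perceives silence or a collision, never a message that would wake it up.\<close>
  show "feedback n (pair_profile u v a b) w \<noteq> Received m" if "w \<notin> {u, v}"
  proof -
    have "pair_profile u v a b w = Receive 1"
      using that by (simp add: pair_profile_def)
    then show ?thesis using * by (simp add: feedback_def)
  qed
qed

lemma kinds_imp_set_zip:
  assumes "map kind as = map kind bs" "(a, b) \<in> set (zip as bs)"
  shows "kind a = kind b"
  using assms by (auto simp: set_zip) (metis length_map nth_map)

lemma view_pair_transcript:
  assumes "u \<in> {1..n}" "v \<in> {1..n}" "u \<noteq> v" "map kind as = map kind bs"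
  shows "view n (pair_transcript u v (as, bs)) u = twin_view as"
    and "view n (pair_transcript u v (as, bs)) v = twin_view bs"
proof -
  have l: "length as = length bs" using assms(4) map_eq_imp_length_eq by blast
  have k: "kind (as ! i) = kind (bs ! i)" if "i < length bs" for i
    using assms(4) l that by (metis nth_map)
  show "view n (pair_transcript u v (as, bs)) u = twin_view as"
    "view n (pair_transcript u v (as, bs)) v = twin_view bs"
    using assms(3) l k
    by (auto intro!: nth_equalityI
        simp: view_def twin_view_def pair_transcript_def feedback_pair_profile[OF assms(1-3)])
      (auto simp: pair_profile_def)
qed

lemma active_pair_transcript:
  assumes "u \<in> {1..n}" "v \<in> {1..n}" "u \<noteq> v" "map kind as = map kind bs"
  shows "active n {u, v} (pair_transcript u v (as, bs)) w \<longleftrightarrow> w \<in> {u, v}"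
  using feedback_pair_profile(3)[OF assms(1-3) kinds_imp_set_zip[OF assms(4)]]
  by (auto simp: active_def pair_transcript_def)

lemma not_solved_pair_transcript:
  assumes "u \<in> {1..n}" "v \<in> {1..n}" "u \<noteq> v" "map kind as = map kind bs"
  shows "\<not> solved n (pair_transcript u v (as, bs))"
  using transmitters_pair_profile[OF assms(1-3) kinds_imp_set_zip[OF assms(4)]] assms(3)
  by (auto simp: solved_def pair_transcript_def split: if_splits)

section \<open>Probability of a transcript of twins\<close>

lemma pmf_Pi_pair_profile:
  assumes "u \<in> {1..n}" "v \<in> {1..n}" "u \<noteq> v"
    and "\<And>w. w \<notin> {u, v} \<Longrightarrow> p w = return_pmf (Receive 1)"
  shows "pmf (Pi_pmf {1..n} (Receive 1) p) (pair_profile u v a b) = pmf (p u) a * pmf (p v) b"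
proof -
  have "pmf (Pi_pmf {1..n} (Receive 1) p) (pair_profile u v a b)
      = (\<Prod>w\<in>{1..n}. pmf (p w) (pair_profile u v a b w))"
    using assms(1,2) by (intro pmf_Pi') (auto simp: pair_profile_def)
  \<comment> \<open>All other nodes choose \<open>Receive 1\<close> surely and contribute the factor
    1.\<close>
  also have "\<dots> = (\<Prod>w\<in>{u, v}. pmf (p w) (pair_profile u v a b w))"
    using assms by (intro prod.mono_neutral_right) (auto simp: pair_profile_def)
  also have "\<dots> = pmf (p u) a * pmf (p v) b"
    using assms(3) by (simp add: pair_profile_def)
  finally show ?thesis .
qed

text \<open>After a past with equal kinds, both views are the twin views and no third node is awake.
  The next round therefore multiplies the mass by exactly the two factors that the isolated runs of
  \<open>u\<close> and \<open>v\<close> acquire.\<close>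

lemma pmf_execution_pair_transcript:
  assumes "u \<in> {1..n}" "v \<in> {1..n}" "u \<noteq> v" "map kind as = map kind bs" "length as = t"
  shows "pmf (execution A n C {u, v} t) (pair_transcript u v (as, bs))
    = pmf (twin_run A n C u t) as * pmf (twin_run A n C v t) bs"
  using assms(4,5)
proof (induction t arbitrary: as bs)
  case 0
  then show ?case by (simp add: pair_transcript_def)
next
  case (Suc t)
  from Suc.prems obtain as' a where as: "as = as' @ [a]"
    by (metis length_Suc_conv_rev)
  from Suc.prems obtain bs' b where bs: "bs = bs' @ [b]"
    by (metis length_Suc_conv_rev length_map)
  have kinds: "map kind as' = map kind bs'" and len: "length as' = t" "length as' = length bs'"
    using Suc.prems as bs by (auto dest: map_eq_imp_length_eq)
  let ?tr = "pair_transcript u v (as', bs')"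
  have snoc: "pair_transcript u v (as, bs) = ?tr @ [pair_profile u v a b]"
    using len by (simp add: as bs pair_transcript_def)
  have "pmf (Pi_pmf {1..n} (Receive 1) (next_action A n C {u, v} ?tr)) (pair_profile u v a b)
      = pmf (A n C u (twin_view as')) a * pmf (A n C v (twin_view bs')) b"
    using assms(1-3) kinds
    by (subst pmf_Pi_pair_profile)
      (auto simp: next_action_def active_pair_transcript view_pair_transcript)
  then show ?case
    unfolding snoc by (simp add: pmf_bind_snoc as bs Suc.IH[OF kinds len(1)])
qed

lemma inj_on_pair_transcript:
  assumes "u \<noteq> v"
  shows "inj_on (pair_transcript u v) {(as, bs). length as = length bs}"
proof (rule inj_on_inverseI)
  fix x :: "'a action list \<times> 'a action list"
  assume "x \<in> {(as, bs). length as = length bs}"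
  \<comment> \<open>The inverse reads off the columns of \<open>u\<close> and \<open>v\<close>.
    Since \<open>map2\<close> truncates to the shorter list, this recovers both lists only when
    their lengths agree.\<close>
  then show "(\<lambda>tr. (map (\<lambda>a. a u) tr, map (\<lambda>a. a v) tr)) (pair_transcript u v x) = x"
    using assms
    by (auto simp: pair_transcript_def pair_profile_def intro!: nth_equalityI)
qed

text \<open>Messages come from an arbitrary type, so the set of pairs of runs need not be finite;
  equal point masses are summed by an infinite sum.\<close>

lemma measure_pmf_transfer:
  assumes "inj_on g D" "\<And>x. x \<in> D \<Longrightarrow> pmf q (g x) = pmf p x"
  shows "measure_pmf.prob q (g ` D) = measure_pmf.prob p D"
  unfolding measure_pmf_conv_infsetsum
  by (subst infsetsum_reindex[OF assms(1)]) (intro infsetsum_cong assms(2) refl)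

section \<open>Sequences of kinds and their collision probability\<close>

definition kind_run :: "'m algorithm \<Rightarrow> nat \<Rightarrow> nat \<Rightarrow> nat \<Rightarrow> nat \<Rightarrow> (bool \<times> nat) list pmf" where
  "kind_run A n C u t = map_pmf (map kind) (twin_run A n C u t)"

text \<open>This makes the counting finite: without the messages, only \<open>2 * C\<close> choices
  per round remain.\<close>

lemma set_kind_run:
  assumes "respects_channels A" "n \<ge> 1" "C \<ge> 1" "u \<in> {1..n}"
  shows "set_pmf (kind_run A n C u t) \<subseteq> {ks. set ks \<subseteq> UNIV \<times> {1..C} \<and> length ks = t}"
proof -
  have "kind a \<in> UNIV \<times> {1..C}"
    if "as \<in> set_pmf (twin_run A n C u t)" "a \<in> set as" for as a
    using that
  proof (induction t arbitrary: as a)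
    case (Suc t)
    from Suc.prems obtain as' a' where
      *: "as' \<in> set_pmf (twin_run A n C u t)" "a' \<in> set_pmf (A n C u (twin_view as'))"
        "as = as' @ [a']"
      by auto
    have "channel a' \<in> {1..C}"
      using assms *(2) unfolding respects_channels_def by blast
    then have "kind a' \<in> UNIV \<times> {1..C}"
      by (cases a') (auto simp: kind_def)
    then show ?case using Suc *(1,3) by auto
  qed simp
  then show ?thesis
    by (auto simp: kind_run_def length_twin_run image_subset_iff)
qed

lemma prob_not_solved_ge:
  assumes "u \<in> {1..n}" "v \<in> {1..n}" "u \<noteq> v" "finite K"
  shows "(\<Sum>k\<in>K. pmf (kind_run A n C u t) k * pmf (kind_run A n C v t) k)
    \<le> measure_pmf.prob (execution A n C {u, v} t) {tr. \<not> solved n tr}"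
proof -
  let ?P = "twin_run A n C u t" and ?Q = "twin_run A n C v t"
  let ?D = "{(as, bs). map kind as = map kind bs \<and> length as = t}"
  \<comment> \<open>The sum is the probability that two independent samples agree in a value from
    \<open>K\<close>, a part of the diagonal.\<close>
  have "(\<Sum>k\<in>K. pmf (kind_run A n C u t) k * pmf (kind_run A n C v t) k)
      = (\<Sum>x\<in>(\<lambda>k. (k, k)) ` K. pmf (pair_pmf (kind_run A n C u t) (kind_run A n C v t)) x)"
    by (subst sum.reindex) (auto simp: inj_on_def pmf_pair)
  also have "\<dots> = measure_pmf.prob (pair_pmf (kind_run A n C u t) (kind_run A n C v t)) ((\<lambda>k. (k, k)) ` K)"
    using assms(4) by (simp add: measure_measure_pmf_finite)
  also have "\<dots> = measure_pmf.prob (map_pmf (map_prod (map kind) (map kind)) (pair_pmf ?P ?Q)) ((\<lambda>k. (k, k)) ` K)"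
    by (simp add: kind_run_def map_prod_def map_pair)
  \<comment> \<open>The condition \<open>length as = t\<close> in \<open>?D\<close> holds only on
    the support of \<open>?P\<close>, hence a comparison almost everywhere.\<close>
  also have "\<dots> \<le> measure_pmf.prob (pair_pmf ?P ?Q) ?D"
    unfolding measure_map_pmf
    by (rule measure_pmf.finite_measure_mono_AE)
      (auto simp: AE_measure_pmf_iff length_twin_run)
  also have "\<dots> = measure_pmf.prob (execution A n C {u, v} t) (pair_transcript u v ` ?D)"
    using assms(1-3)
    by (intro measure_pmf_transfer[symmetric] inj_on_subset[OF inj_on_pair_transcript])
      (auto simp: pmf_execution_pair_transcript pmf_pair dest: map_eq_imp_length_eq)
  also have "\<dots> \<le> measure_pmf.prob (execution A n C {u, v} t) {tr. \<not> solved n tr}"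
    using assms(1-3)
    by (intro measure_pmf.finite_measure_mono) (auto simp: not_solved_pair_transcript)
  finally show ?thesis .
qed

text \<open>Second moment argument: the column sums over \<open>K\<close> add up to
  \<open>card I\<close>, and their squares expand into the collision probabilities of all ordered
  pairs.\<close>

lemma card_ge_of_collision_prob_le:
  fixes p :: "'i \<Rightarrow> 'b pmf"
  assumes "finite I" "finite K" "\<And>i. i \<in> I \<Longrightarrow> set_pmf (p i) \<subseteq> K"
    and "\<And>i j. i \<in> I \<Longrightarrow> j \<in> I \<Longrightarrow> i \<noteq> j \<Longrightarrow> (\<Sum>k\<in>K. pmf (p i) k * pmf (p j) k) \<le> 1 / card I"
  shows "card I \<le> 2 * card K"
proof (cases "I = {}")
  case False
  let ?n = "real (card I)"
  have n: "?n > 0" using False assms(1) by (simp add: card_gt_0_iff)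
  have one: "(\<Sum>k\<in>K. pmf (p i) k) = 1" if "i \<in> I" for i
    using assms(2,3) that by (intro sum_pmf_eq_1) auto
  \<comment> \<open>On the diagonal only the trivial bound 1 is available. Adding
    \<open>1 / ?n\<close> there too makes the double sum equal to n + n^2 / n = 2 n.\<close>
  have coll: "(\<Sum>k\<in>K. pmf (p i) k * pmf (p j) k) \<le> (if i = j then 1 else 0) + 1 / ?n"
    if "i \<in> I" "j \<in> I" for i j
  proof (cases "i = j")
    case True
    have "(\<Sum>k\<in>K. pmf (p i) k * pmf (p j) k) \<le> (\<Sum>k\<in>K. pmf (p i) k)"
      by (intro sum_mono) (simp add: mult_left_le pmf_le_1)
    also have "\<dots> = 1" using one that by simp
    finally show ?thesis using True n by (simp add: add_increasing2)
  next
    case False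
    then show ?thesis using assms(4) that by simp
  qed
  have "?n\<^sup>2 = (\<Sum>i\<in>I. \<Sum>k\<in>K. pmf (p i) k)\<^sup>2"
    using one by simp
  also have "\<dots> = (\<Sum>k\<in>K. \<Sum>i\<in>I. pmf (p i) k)\<^sup>2"
    by (subst sum.swap) simp
  also have "\<dots> \<le> (\<Sum>k\<in>K. (\<Sum>i\<in>I. pmf (p i) k)\<^sup>2) * card K"
    by (rule sum_squared_le_sum_of_squares)
  also have "(\<Sum>k\<in>K. (\<Sum>i\<in>I. pmf (p i) k)\<^sup>2)
      = (\<Sum>k\<in>K. \<Sum>i\<in>I. \<Sum>j\<in>I. pmf (p i) k * pmf (p j) k)"
    by (simp add: power2_eq_square sum_product)
  also have "\<dots> = (\<Sum>i\<in>I. \<Sum>j\<in>I. \<Sum>k\<in>K. pmf (p i) k * pmf (p j) k)"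
    by (subst sum.swap, intro sum.cong refl, rule sum.swap)
  also have "\<dots> \<le> (\<Sum>i\<in>I. \<Sum>j\<in>I. (if i = j then 1 else 0) + 1 / ?n)"
    by (intro sum_mono coll)
  also have "\<dots> = 2 * ?n"
    using n assms(1) by (simp add: sum.distrib)
  finally have "?n * ?n \<le> ?n * (2 * card K)"
    by (simp add: power2_eq_square mult_right_mono mult_ac)
  then show ?thesis
    using n by (simp add: mult_le_cancel_left_pos)
qed simp

section \<open>The bound on the number of rounds and its asymptotics\<close>

lemma wakeup_rounds_lower_bound:
  assumes "respects_channels A" "solves_wakeup_whp A f" "n \<ge> 1" "C \<ge> 1"
  shows "n \<le> 2 * (2 * C) ^ f n C"
proof -
  let ?p = "\<lambda>u. kind_run A n C u (f n C)"
  let ?K = "{ks. set ks \<subseteq> (UNIV :: bool set) \<times> {1..C} \<and> length ks = f n C}"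
  have fin: "finite ?K" by (intro finite_lists_length_eq) simp
  \<comment> \<open>Each pair fails with probability at most 1/n, which is the threshold
    \<open>1 / card I\<close> for the index set of all n nodes.\<close>
  have "(\<Sum>k\<in>?K. pmf (?p u) k * pmf (?p v) k) \<le> 1 / card {1..n}"
    if uv: "u \<in> {1..n}" "v \<in> {1..n}" "u \<noteq> v" for u v
  proof -
    let ?E = "execution A n C {u, v} (f n C)"
    have "measure_pmf.prob ?E {tr. solved n tr} \<ge> 1 - 1 / real n"
      using assms(2-4) uv unfolding solves_wakeup_whp_def by simp
    moreover have "measure_pmf.prob ?E {tr. \<not> solved n tr} = 1 - measure_pmf.prob ?E {tr. solved n tr}"
      using measure_pmf.prob_compl[of "{tr. solved n tr}" ?E]
      by (simp add: Compl_eq_Diff_UNIV[symmetric] Collect_neg_eq)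
    ultimately show ?thesis
      using prob_not_solved_ge[OF uv fin, of A C "f n C"] by simp
  qed
  then have "card {1..n} \<le> 2 * card ?K"
    by (intro card_ge_of_collision_prob_le[where p = ?p] fin set_kind_run[OF assms(1,3,4)]) simp_all
  also have "card ?K = (2 * C) ^ f n C"
    by (subst card_lists_length_eq) (simp_all add: card_cartesian_product)
  finally show ?thesis by simp
qed

theorem theorem8p1:
  fixes A :: "'m algorithm" and f :: "nat \<Rightarrow> nat \<Rightarrow> nat"
  assumes "respects_channels A"
    and "solves_wakeup_whp A f"
  shows "\<forall>C::nat. C \<ge> 2 \<longrightarrow>
           (\<lambda>n::nat. real (f n C)) \<in> \<Omega>(\<lambda>n::nat. ln (real n) / ln (real C) + ln (ln (real n)))"
proof (intro allI impI)
  fix C :: nat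
  assume C: "C \<ge> 2"
  \<comment> \<open>\<open>a\<close> is the denominator in the claim, \<open>b\<close> the logarithm
    of the number of kinds available in one round.\<close>
  define a b where "a = ln (real C)" and "b = ln (2 * real C)"
  have ab: "a > 0" "b > 0" using C by (simp_all add: a_def b_def)
  have "ln (real n / 2) / b \<le> real (f n C)" if "n \<ge> 1" for n
  proof -
    have "real n \<le> real (2 * (2 * C) ^ f n C)"
      using wakeup_rounds_lower_bound[OF assms that, of C] C by (subst of_nat_le_iff) simp
    then have "ln (real n / 2) \<le> ln ((2 * real C) ^ f n C)"
      using that C by (subst ln_le_cancel_iff) simp_all
    also have "\<dots> = real (f n C) * b"
      unfolding b_def by (rule ln_realpow)
    finally show ?thesis using ab by (simp add: field_simps)
  qed
  then have "eventually (\<lambda>n. norm (ln (real n / 2) / b) \<le> norm (real (f n C))) at_top"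
    using ab by (intro eventually_mono[OF eventually_ge_at_top[of 2]]) simp
  then have "(\<lambda>n. ln (real n / 2) / b) \<in> O(\<lambda>n. real (f n C))"
    by (rule landau_o.big_mono)
  \<comment> \<open>Both \<open>a\<close> and \<open>b\<close> are positive constants here, and the
    factor 1/2 costs only the additive constant ln 2.\<close>
  moreover have "(\<lambda>n::nat. ln (real n) / a + ln (ln (real n))) \<in> O(\<lambda>n. ln (real n / 2) / b)"
    using ab by real_asymp
  ultimately show "(\<lambda>n. real (f n C)) \<in> \<Omega>(\<lambda>n. ln (real n) / ln (real C) + ln (ln (real n)))"
    unfolding a_def bigomega_iff_bigo by (rule landau_o.big.trans[rotated])
qed

end
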